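(* For all integers $m\geq 2$ and $n\geq 1$, the following identity of polynomials in the indeterminate $x$ holds: $$\sum_{T\in \mathcal{T}_{n,m}}\ \prod_{v\in \mathcal{I}(T)}\Big(x+\frac{1}{\mathcal{H}_v}\Big)=\frac{x+1}{n!}\prod_{i=1}^{n-1}\Big((mn+1-i)(x+1)-(m-1)i\Big),$$ or equivalently, $$\sum_{T\in \mathcal{T}_{n,m}}\ \prod_{v\in \mathcal{I}(T)}\frac{(m\mathcal{H}_v-1)x-\mathcal{H}_v+1}{(m-1)\mathcal{H}_v}=\frac{1}{mn+1}\binom{(mn+1)x}{n}.$$ (Both identities are asserted.)
   Context: A complete $m$-ary tree is an unlabeled rooted plane tree in which every internal (non-leaf) vertex has exactly $m$ children, linearly ordered from left to right; the tree consisting of a single leaf is the unique one with no internal vertices. $\mathcal{T}_{n,m}$ denotes the (finite) set of complete $m$-ary trees with exactly $n$ internal vertices, and $\mathcal{I}(T)$ denotes the set of internal vertices of $T$. First kind of hook length: for an internal vertex $v$ of a complete $m$-ary tree $T$, let $T_v$ be the subtree of $T$ rooted at $v$ (consisting of $v$ and all its descendants), and let $T'_v$ be obtained from $T_v$ by removing the rightmost ($m$-th) subtree of $v$. Then $\mathcal{H}_v$ is the number of internal vertices of $T$ lying in $T'_v$, counting $v$ itself; that is, if the $m$ subtrees of $v$ from left to right have $i_1,\dots,i_m$ internal vertices, then $\mathcal{H}_v=1+i_1+\cdots+i_{m-1}$. The binomial coefficient is the polynomial $\binom{y}{n}=\frac{y(y-1)\cdots(y-n+1)}{n!}$, and empty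 products equal $1$. *)

theory Defs
  imports "HOL-Computational_Algebra.Polynomial"
begin

text \<open>Unlabeled rooted plane trees: children are listed from left to right, and \<open>Node []\<close> is the
  tree consisting of a single leaf.\<close>

datatype plane_tree = Node (children: "plane_tree list")

text \<open>A vertex is addressed by the list of child indices (counted from 0) on the path leading to it
  from the root. The address of a vertex \<open>u\<close> of \<open>subtree_at T v\<close> in \<open>T\<close> is thus \<open>v @ u\<close>.\<close>

inductive is_vertex :: "plane_tree \<Rightarrow> nat list \<Rightarrow> bool" where
  "is_vertex T []"
| "i < length (children T) \<Longrightarrow> is_vertex (children T ! i) v \<Longrightarrow> is_vertex T (i # v)"

definition vertices :: "plane_tree \<Rightarrow> nat list set" where
  "vertices T = {v. is_vertex T v}"

primrec subtree_at :: "plane_tree \<Rightarrow> nat list \<Rightarrow> plane_tree" where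
  "subtree_at T [] = T"
| "subtree_at T (i # v) = subtree_at (children T ! i) v"

definition internal_vertices :: "plane_tree \<Rightarrow> nat list set" where
  "internal_vertices T = {v \<in> vertices T. children (subtree_at T v) \<noteq> []}"

definition complete_mary :: "nat \<Rightarrow> plane_tree \<Rightarrow> bool" where
  "complete_mary m T \<longleftrightarrow> (\<forall>v \<in> internal_vertices T. length (children (subtree_at T v)) = m)"

definition mary_trees :: "nat \<Rightarrow> nat \<Rightarrow> plane_tree set" where
  "mary_trees n m = {T. complete_mary m T \<and> card (internal_vertices T) = n}"

definition remove_rightmost :: "plane_tree \<Rightarrow> plane_tree" where
  "remove_rightmost T = Node (butlast (children T))"

text \<open>Removing the rightmost subtree does not change the addresses of the remaining vertices, so
  \<open>v @ u\<close> below is the vertex of \<open>T\<close> corresponding to the vertex \<open>u\<close> of the pruned subtree.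
  Whether it is internal is judged in \<open>T\<close>.\<close>

definition hook :: "plane_tree \<Rightarrow> nat list \<Rightarrow> nat" where
  "hook T v = card {w \<in> internal_vertices T.
     \<exists>u \<in> vertices (remove_rightmost (subtree_at T v)). w = v @ u}"

abbreviation X :: "rat poly" where
  "X \<equiv> [:0, 1:]"

text \<open>\<open>gchoose\<close> is not used because its type is constrained to \<open>field_char_0\<close> here, which
  polynomials are not.\<close>

definition binomial_poly :: "rat poly \<Rightarrow> nat \<Rightarrow> rat poly" where
  "binomial_poly y n = smult (1 / fact n) (\<Prod>i<n. y - of_nat i)"

end

theory Submission
  imports Defs "HOL-Computational_Algebra.Formal_Power_Series"
begin

text \<open>
  The second identity is proved first, at each positive integer \<open>x = t\<close>; as both sides are
  polynomials, this suffices. There the weight of a vertex with hook length \<open>h\<close> has the form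
  \<open>a + b / h\<close> with constants \<open>a\<close> and \<open>b\<close>, and the weight of a tree is the product of its vertex
  weights.

  Let \<open>F\<close> be the generating function, in the variable \<open>z\<close>, of the weighted trees by number of internal
  vertices. The hook length of the root depends only on the first \<open>m - 1\<close> subtrees, so splitting
  off the last one gives \<open>F = 1 + Q F\<close>, where the coefficient of \<open>z^(j + 1)\<close> in \<open>Q\<close> is
  \<open>a + b / (j + 1)\<close> times the coefficient of \<open>z^j\<close> in \<open>F^(m - 1)\<close>. Equivalently,
  \<open>Q = a z F^(m - 1) + b \<integral> F^(m - 1)\<close>. The equation determines \<open>F\<close>
  (\<open>hook_recurrence_tree_gf\<close>, \<open>hook_recurrence_unique\<close>).

  Put \<open>s = m t\<close>. The expected coefficients are those of \<open>B^t\<close>, where \<open>B = 1 + z B^s\<close> is the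
  generalized binomial series: the coefficient of \<open>z^n\<close> in \<open>B^r\<close> is
  \<open>r / (s n + r) * binom(s n + r, n)\<close>. Instead of Lagrange inversion, the series \<open>C_r\<close>
  with these coefficients are compared with each other: they satisfy
  \<open>C_(r+1) = C_r + z C_(r+s)\<close>, the same relation as powers of \<open>B\<close>, and an induction gives
  \<open>C_r C_q = C_(r+q)\<close>; hence \<open>B = C_1\<close> and \<open>C_r = B^r\<close>. That \<open>A = B^t\<close> solves \<open>A = 1 + Q A\<close>,
  that is, \<open>1 - 1 / A = Q\<close>, is seen by differentiating
  (\<open>hook_recurrence_binomial_series\<close>): both derivatives reduce to the differential
  equation that \<open>B = 1 + z B^s\<close> implies.

  The first identity is the second one evaluated at \<open>(x + 1) / (x + m)\<close> and multiplied by
  \<open>(x + m)^n\<close>, one factor \<open>x + m\<close> for each internal vertex.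
\<close>

section \<open>Recursive structure of trees and hook lengths\<close>

lemma vertices_Node:
  "vertices (Node ts) = insert [] (\<Union>i<length ts. (#) i ` vertices (ts ! i))"
proof -
  have "is_vertex (Node ts) v \<longleftrightarrow>
      v = [] \<or> (\<exists>i<length ts. \<exists>u. v = i # u \<and> is_vertex (ts ! i) u)" for v
    by (subst is_vertex.simps) auto
  then show ?thesis
    by (auto simp: vertices_def)
qed

lemma finite_vertices: "finite (vertices T)"
  by (induction T) (auto simp: vertices_Node)

lemma internal_vertices_subset: "internal_vertices T \<subseteq> vertices T"
  by (auto simp: internal_vertices_def)

lemma finite_internal_vertices: "finite (internal_vertices T)"
  using finite_vertices internal_vertices_subset finite_subset by blast

lemma internal_vertices_leaf: "internal_vertices (Node []) = {}"
  by (auto simp: internal_vertices_def vertices_Node)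

lemma internal_vertices_Node:
  "ts \<noteq> [] \<Longrightarrow> internal_vertices (Node ts) =
     insert [] (\<Union>i<length ts. (#) i ` internal_vertices (ts ! i))"
  by (auto simp: internal_vertices_def vertices_Node)

abbreviation tree_size :: "plane_tree \<Rightarrow> nat" where
  "tree_size T \<equiv> card (internal_vertices T)"

lemma card_insert_Nil_UN_Cons:
  fixes k :: nat
  assumes "\<And>i. i < k \<Longrightarrow> finite (A i)"
  shows "card (insert [] (\<Union>i<k. (#) i ` A i)) = Suc (\<Sum>i<k. card (A i))"
proof -
  have "card (\<Union>i<k. (#) i ` A i) = (\<Sum>i<k. card ((#) i ` A i))"
    by (rule card_UN_disjoint) (auto simp: assms)
  also have "\<dots> = (\<Sum>i<k. card (A i))"
    by (simp add: card_image)
  finally show ?thesis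
    using assms by (subst card_insert_disjoint) auto
qed

lemma tree_size_Node:
  assumes "ts \<noteq> []"
  shows "tree_size (Node ts) = Suc (\<Sum>T\<leftarrow>ts. tree_size T)"
  using assms
  by (simp add: internal_vertices_Node card_insert_Nil_UN_Cons finite_internal_vertices
        sum_list_sum_nth atLeast0LessThan)

text \<open>Passing to a subtree only prefixes all addresses by the index of that subtree, and a hook
  length counts vertices below its own vertex.\<close>

lemma hook_Cons:
  assumes "i < length ts"
  shows "hook (Node ts) (i # v) = hook (ts ! i) v"
proof -
  let ?V = "vertices (remove_rightmost (subtree_at (ts ! i) v))"
  have "ts \<noteq> []"
    using assms by auto
  then have "{w \<in> internal_vertices (Node ts). \<exists>u\<in>?V. w = (i # v) @ u} =
        (#) i ` {w \<in> internal_vertices (ts ! i). \<exists>u\<in>?V. w = v @ u}"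
    using assms by (auto simp: internal_vertices_Node)
  then show ?thesis
    by (simp add: hook_def card_image)
qed

lemma hook_root:
  "hook (Node (us @ [T])) [] = Suc (\<Sum>U\<leftarrow>us. tree_size U)"
proof -
  have "{w \<in> internal_vertices (Node (us @ [T])). w \<in> vertices (Node us)} =
        insert [] (\<Union>i<length us. (#) i ` internal_vertices (us ! i))"
    by (auto simp: internal_vertices_Node vertices_Node nth_append
          dest: subsetD[OF internal_vertices_subset])
  then show ?thesis
    by (simp add: hook_def remove_rightmost_def card_insert_Nil_UN_Cons finite_internal_vertices
          sum_list_sum_nth atLeast0LessThan)
qed

text \<open>Positivity makes the reciprocals of hook lengths in the weights genuine ones: division by
  zero, which yields zero, never occurs.\<close>

lemma hook_pos:
  assumes "v \<in> internal_vertices T"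
  shows "hook T v > 0"
proof -
  have "v \<in> {w \<in> internal_vertices T.
      \<exists>u\<in>vertices (remove_rightmost (subtree_at T v)). w = v @ u}"
    using assms by (auto simp: vertices_Node remove_rightmost_def)
  then show ?thesis
    unfolding hook_def by (subst card_gt_0_iff) (auto simp: finite_internal_vertices)
qed

definition hook_weight :: "(nat \<Rightarrow> 'a::comm_monoid_mult) \<Rightarrow> plane_tree \<Rightarrow> 'a" where
  "hook_weight g T = (\<Prod>v\<in>internal_vertices T. g (hook T v))"

lemma hook_weight_leaf: "hook_weight g (Node []) = 1"
  by (simp add: hook_weight_def internal_vertices_leaf)

text \<open>The children are written as \<open>us @ [T]\<close> because the weight at the root depends on \<open>us\<close> only.
  Every other vertex contributes as in its own subtree.\<close>

lemma hook_weight_Node: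
  "hook_weight g (Node (us @ [T])) =
     g (Suc (\<Sum>U\<leftarrow>us. tree_size U)) * (\<Prod>U\<leftarrow>us. hook_weight g U) * hook_weight g T"
proof -
  let ?ts = "us @ [T]"
  have "hook_weight g (Node ?ts) = g (hook (Node ?ts) []) *
      (\<Prod>v\<in>(\<Union>i<length ?ts. (#) i ` internal_vertices (?ts ! i)). g (hook (Node ?ts) v))"
    unfolding hook_weight_def
    by (subst internal_vertices_Node, simp, subst prod.insert) (auto simp: finite_internal_vertices)
  also have "(\<Prod>v\<in>(\<Union>i<length ?ts. (#) i ` internal_vertices (?ts ! i)). g (hook (Node ?ts) v)) =
      (\<Prod>i<length ?ts. \<Prod>v\<in>(#) i ` internal_vertices (?ts ! i). g (hook (Node ?ts) v))"
    by (rule prod.UNION_disjoint) (auto simp: finite_internal_vertices)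
  also have "\<dots> = (\<Prod>i<length ?ts. hook_weight g (?ts ! i))"
    by (rule prod.cong[OF refl]) (simp add: prod.reindex hook_Cons hook_weight_def)
  also have "\<dots> = (\<Prod>U\<leftarrow>?ts. hook_weight g U)"
    by (simp add: prod.list_conv_set_nth atLeast0LessThan nth_append)
  finally show ?thesis
    by (simp add: hook_root mult.assoc)
qed

section \<open>Generating functions of complete trees\<close>

lemma complete_mary_Node:
  assumes "m > 0"
  shows "complete_mary m (Node ts) \<longleftrightarrow>
     ts = [] \<or> length ts = m \<and> (\<forall>T\<in>set ts. complete_mary m T)"
  by (cases "ts = []")
     (auto simp: complete_mary_def internal_vertices_leaf internal_vertices_Node
        all_set_conv_all_nth)

definition forests :: "nat \<Rightarrow> nat \<Rightarrow> nat \<Rightarrow> plane_tree list set" where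
  "forests m k n =
     {ts. length ts = k \<and> (\<forall>T\<in>set ts. complete_mary m T) \<and> (\<Sum>T\<leftarrow>ts. tree_size T) = n}"

lemma forests_0: "forests m 0 n = (if n = 0 then {[]} else {})"
  by (auto simp: forests_def)

lemma forests_Suc:
  "forests m (Suc k) n =
     (\<Union>j\<le>n. (\<lambda>(us, T). us @ [T]) ` (forests m k j \<times> mary_trees (n - j) m))"
proof (intro set_eqI iffI)
  fix ts assume ts: "ts \<in> forests m (Suc k) n"
  then obtain us T where "ts = us @ [T]"
    by (cases ts rule: rev_cases) (auto simp: forests_def)
  with ts show "ts \<in> (\<Union>j\<le>n. (\<lambda>(us, T). us @ [T]) ` (forests m k j \<times> mary_trees (n - j) m))"
    by (auto simp: forests_def mary_trees_def intro!: bexI[of _ "\<Sum>T\<leftarrow>us. tree_size T"])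
qed (auto simp: forests_def mary_trees_def)

lemma mary_trees_0: "m > 0 \<Longrightarrow> mary_trees 0 m = {Node []}"
proof (intro set_eqI iffI)
  fix T assume T: "T \<in> mary_trees 0 m" "m > 0"
  obtain ts where ts: "T = Node ts"
    by (cases T)
  with T have "ts = []"
    using tree_size_Node[of ts] by (cases "ts = []") (auto simp: mary_trees_def)
  with ts show "T \<in> {Node []}"
    by simp
qed (auto simp: mary_trees_def complete_mary_Node internal_vertices_leaf)

lemma mary_trees_Suc:
  assumes "m > 0"
  shows "mary_trees (Suc n) m = Node ` forests m m n"
proof (intro set_eqI iffI)
  fix T assume T: "T \<in> mary_trees (Suc n) m"
  obtain ts where ts: "T = Node ts"
    by (cases T)
  with T have "ts \<noteq> []"
    by (auto simp: mary_trees_def internal_vertices_leaf)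
  with T ts assms show "T \<in> Node ` forests m m n"
    by (auto simp: mary_trees_def forests_def complete_mary_Node tree_size_Node)
next
  fix T assume "T \<in> Node ` forests m m n"
  then obtain ts where ts: "T = Node ts" "ts \<in> forests m m n"
    by blast
  then have "ts \<noteq> []"
    using assms by (auto simp: forests_def)
  with ts assms show "T \<in> mary_trees (Suc n) m"
    by (auto simp: mary_trees_def forests_def complete_mary_Node tree_size_Node)
qed

lemma finite_forests:
  assumes "\<And>j. j \<le> n \<Longrightarrow> finite (mary_trees j m)"
  shows "finite (forests m k n)"
  using assms
proof (induction k arbitrary: n)
  case (Suc k)
  then show ?case
    by (auto simp: forests_Suc)
qed (simp add: forests_0)

lemma finite_mary_trees:
  assumes "m > 0"
  shows "finite (mary_trees n m)"
proof (induction n rule: less_induct)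
  case (less n)
  then show ?case
    using assms by (cases n) (auto simp: mary_trees_0 mary_trees_Suc intro!: finite_forests)
qed

lemma sum_forests_Suc:
  assumes "m > 0"
  shows "(\<Sum>ts\<in>forests m (Suc k) n. h ts) =
     (\<Sum>j\<le>n. \<Sum>us\<in>forests m k j. \<Sum>T\<in>mary_trees (n - j) m. h (us @ [T]))"
proof -
  let ?B = "\<lambda>j. forests m k j \<times> mary_trees (n - j) m"
  let ?c = "\<lambda>(us, T). us @ [T] :: plane_tree list"
  have fin: "finite (forests m k j)" for k j
    using finite_mary_trees finite_forests assms by blast
  have "(\<Sum>ts\<in>forests m (Suc k) n. h ts) = (\<Sum>j\<le>n. \<Sum>ts\<in>?c ` ?B j. h ts)"
    unfolding forests_Suc
    by (rule sum.UNION_disjoint)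
       (auto simp: fin finite_mary_trees assms, auto simp: forests_def)
  also have "\<dots> = (\<Sum>j\<le>n. \<Sum>p\<in>?B j. h (?c p))"
    by (intro sum.cong refl, subst sum.reindex) (auto simp: inj_on_def)
  also have "\<dots> = (\<Sum>j\<le>n. \<Sum>us\<in>forests m k j. \<Sum>T\<in>mary_trees (n - j) m. h (us @ [T]))"
    by (simp add: sum.cartesian_product split_def)
  finally show ?thesis .
qed

definition tree_gf :: "nat \<Rightarrow> (nat \<Rightarrow> 'a::comm_ring_1) \<Rightarrow> 'a fps" where
  "tree_gf m g = Abs_fps (\<lambda>n. \<Sum>T\<in>mary_trees n m. hook_weight g T)"

text \<open>Splitting off the last tree of a forest turns sums over forests into Cauchy products.\<close>

lemma sum_forests_eq_power:
  assumes "m > 0"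
  shows "(\<Sum>ts\<in>forests m k n. \<Prod>T\<leftarrow>ts. hook_weight g T) = fps_nth (tree_gf m g ^ k) n"
proof (induction k arbitrary: n)
  case 0
  then show ?case
    by (simp add: forests_0)
next
  case (Suc k)
  have "(\<Sum>ts\<in>forests m (Suc k) n. \<Prod>T\<leftarrow>ts. hook_weight g T) =
    (\<Sum>j\<le>n. (\<Sum>us\<in>forests m k j. \<Prod>T\<leftarrow>us. hook_weight g T) *
       (\<Sum>T\<in>mary_trees (n - j) m. hook_weight g T))"
    by (simp add: sum_forests_Suc assms sum_product)
  then show ?case
    by (simp add: Suc power_Suc2 fps_mult_nth atLeast0AtMost tree_gf_def del: power_Suc)
qed

text \<open>The coefficientwise form of \<open>F = 1 + Q * F\<close> for the series \<open>Q\<close> whose coefficient at \<open>j + 1\<close>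
  is \<open>g (j + 1)\<close> times the coefficient of \<open>F ^ k\<close> at \<open>j\<close>.\<close>

definition hook_recurrence :: "nat \<Rightarrow> (nat \<Rightarrow> 'a::comm_ring_1) \<Rightarrow> 'a fps \<Rightarrow> bool" where
  "hook_recurrence k g F \<longleftrightarrow> fps_nth F 0 = 1 \<and>
     (\<forall>n. fps_nth F (Suc n) = (\<Sum>j\<le>n. g (Suc j) * fps_nth (F ^ k) j * fps_nth F (n - j)))"

text \<open>In a tree with \<open>n + 1\<close> internal vertices, \<open>j\<close> is the number of those lying in the first \<open>k\<close>
  subtrees of the root; the hook length of the root is then \<open>j + 1\<close>.\<close>

lemma hook_recurrence_tree_gf: "hook_recurrence k g (tree_gf (Suc k) g)"
  unfolding hook_recurrence_def
proof (intro conjI allI)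
  show "fps_nth (tree_gf (Suc k) g) 0 = 1"
    by (simp add: tree_gf_def mary_trees_0 hook_weight_leaf)
  fix n
  have "fps_nth (tree_gf (Suc k) g) (Suc n) =
      (\<Sum>ts\<in>forests (Suc k) (Suc k) n. hook_weight g (Node ts))"
    by (simp add: tree_gf_def mary_trees_Suc sum.reindex inj_on_def)
  also have "\<dots> = (\<Sum>j\<le>n. \<Sum>us\<in>forests (Suc k) k j. \<Sum>T\<in>mary_trees (n - j) (Suc k).
      g (Suc j) * (\<Prod>U\<leftarrow>us. hook_weight g U) * hook_weight g T)"
    by (subst sum_forests_Suc, simp)
       (auto simp: hook_weight_Node forests_def intro!: sum.cong)
  also have "\<dots> = (\<Sum>j\<le>n. g (Suc j) * (\<Sum>us\<in>forests (Suc k) k j. \<Prod>U\<leftarrow>us. hook_weight g U) *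
      (\<Sum>T\<in>mary_trees (n - j) (Suc k). hook_weight g T))"
    by (simp add: mult.assoc sum_product flip: sum_distrib_left)
  finally show "fps_nth (tree_gf (Suc k) g) (Suc n) =
      (\<Sum>j\<le>n. g (Suc j) * fps_nth (tree_gf (Suc k) g ^ k) j * fps_nth (tree_gf (Suc k) g) (n - j))"
    by (simp add: sum_forests_eq_power) (simp add: tree_gf_def)
qed

lemma fps_power_nth_cong:
  assumes "\<And>i. i \<le> n \<Longrightarrow> fps_nth F i = fps_nth G i"
  shows "fps_nth (F ^ k) n = fps_nth (G ^ k) n"
  using assms
proof (induction k arbitrary: n)
  case (Suc k)
  then show ?case
    by (auto simp: fps_mult_nth intro!: sum.cong)
qed simp

lemma hook_recurrence_unique:
  assumes F: "hook_recurrence k g F" and G: "hook_recurrence k g G"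
  shows "F = G"
proof (rule fps_ext)
  fix n
  show "fps_nth F n = fps_nth G n"
  proof (induction n rule: less_induct)
    case (less n)
    show ?case
    proof (cases n)
      case 0
      with F G show ?thesis
        by (simp add: hook_recurrence_def)
    next
      case (Suc l)
      have "fps_nth (F ^ k) j = fps_nth (G ^ k) j" "fps_nth F (l - j) = fps_nth G (l - j)"
        if "j \<le> l" for j
        using that less Suc by (auto intro!: fps_power_nth_cong)
      with F G Suc show ?thesis
        by (simp add: hook_recurrence_def)
    qed
  qed
qed

section \<open>The generalized binomial series\<close>

text \<open>The case \<open>n = 0\<close> is separate because the formula would give \<open>0 / 0\<close>, hence \<open>0\<close>, for
  \<open>n = r = 0\<close>, while the series with \<open>r = 0\<close> has to be \<open>1\<close>.\<close>

definition rothe_coeff :: "nat \<Rightarrow> nat \<Rightarrow> nat \<Rightarrow> rat" where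
  "rothe_coeff s r n =
     (if n = 0 then 1 else of_nat r / of_nat (s * n + r) * of_nat ((s * n + r) choose n))"

text \<open>With \<open>N = s (n + 1) + r\<close>, all three terms are rational multiples of \<open>N choose n\<close>, and the claim
  reduces to \<open>(r + 1) N = r (N - n) + (r + s) (n + 1)\<close>.\<close>

lemma rothe_coeff_Suc:
  assumes "s > 0"
  shows "rothe_coeff s (Suc r) (Suc n) = rothe_coeff s r (Suc n) + rothe_coeff s (r + s) n"
proof -
  define N where "N = s * Suc n + r"
  have N: "n < N" "N > 0"
  proof -
    have "1 * Suc n \<le> s * Suc n"
      using assms by (intro mult_le_mono1) simp
    then show "n < N"
      by (simp add: N_def)
    then show "N > 0"
      by simp
  qed
  define b :: rat where "b = of_nat (N choose n)"
  have 1: "of_nat (N choose Suc n) * of_nat (Suc n) = b * (of_nat N - of_nat n)"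
  proof -
    have "(N choose Suc n) * Suc n = (N choose n) * (N - n)"
      using binomial_absorb_comp[of N n] Suc_times_binomial_eq[of "N - 1" n] N by (simp add: ac_simps)
    then have "of_nat ((N choose Suc n) * Suc n) = (of_nat ((N choose n) * (N - n)) :: rat)"
      by (rule arg_cong)
    then show ?thesis
      using N by (simp add: b_def algebra_simps)
  qed
  have 2: "of_nat (Suc N choose Suc n) * of_nat (Suc n) = of_nat (Suc N) * b"
    using Suc_times_binomial_eq[of N n] unfolding b_def of_nat_mult[symmetric] by presburger
  have r1: "rothe_coeff s (Suc r) (Suc n) = of_nat (Suc r) / of_nat (Suc n) * b"
  proof -
    have "rothe_coeff s (Suc r) (Suc n) = of_nat (Suc r) / of_nat (Suc N) * of_nat (Suc N choose Suc n)"
      by (simp add: rothe_coeff_def N_def)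
    also have "\<dots> = of_nat (Suc r) / of_nat (Suc n) * b"
      using 2 by (simp add: field_simps del: of_nat_Suc binomial_Suc_Suc)
    finally show ?thesis .
  qed
  have r2: "rothe_coeff s r (Suc n) =
      of_nat r / of_nat N * (b * (of_nat N - of_nat n) / of_nat (Suc n))"
    unfolding 1[symmetric] by (simp add: rothe_coeff_def N_def)
  have r3: "rothe_coeff s (r + s) n = of_nat (r + s) / of_nat N * b"
    using assms by (auto simp: rothe_coeff_def b_def N_def algebra_simps)
  have NN: "of_nat N = of_nat s * (1 + of_nat n) + (of_nat r :: rat)"
    by (simp add: N_def algebra_simps)
  have "(of_nat (Suc r) * of_nat N :: rat) =
      of_nat r * (of_nat N - of_nat n) + of_nat (r + s) * of_nat (Suc n)"
    by (simp add: NN algebra_simps)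
  then have E: "of_nat (Suc r) / of_nat (Suc n) =
      of_nat r / of_nat N * ((of_nat N - of_nat n) / of_nat (Suc n)) +
      of_nat (r + s) / (of_nat N :: rat)"
    using N by (simp add: field_simps del: of_nat_Suc of_nat_add)
  show ?thesis
    unfolding r1 r2 r3 E by (simp add: distrib_left distrib_right ac_simps del: of_nat_Suc of_nat_add)
qed

definition binomial_series :: "nat \<Rightarrow> nat \<Rightarrow> rat fps" where
  "binomial_series s r = Abs_fps (rothe_coeff s r)"

lemma binomial_series_0: "binomial_series s 0 = 1"
  by (rule fps_ext) (simp add: binomial_series_def rothe_coeff_def)

lemma binomial_series_Suc:
  assumes "s > 0"
  shows "binomial_series s (Suc r) = binomial_series s r + fps_X * binomial_series s (r + s)"
proof (rule fps_ext)
  fix n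
  show "fps_nth (binomial_series s (Suc r)) n =
      fps_nth (binomial_series s r + fps_X * binomial_series s (r + s)) n"
    using rothe_coeff_Suc[OF assms]
    by (cases n) (auto simp: binomial_series_def rothe_coeff_def)
qed

text \<open>Both sides satisfy the recurrence of \<open>binomial_series_Suc\<close> in \<open>r\<close>. Its second term has a
  factor \<open>fps_X\<close>, which lowers \<open>n\<close>, so the outer induction on \<open>n\<close> (for all \<open>r\<close>) covers the
  larger index \<open>r + s\<close>, and the inner one on \<open>r\<close> covers the first term.\<close>

lemma binomial_series_add:
  assumes "s > 0"
  shows "binomial_series s r * binomial_series s q = binomial_series s (r + q)"
proof (rule fps_ext)
  fix n
  show "fps_nth (binomial_series s r * binomial_series s q) n = fps_nth (binomial_series s (r + q)) n"
  proof (induction n arbitrary: r rule: less_induct)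
    case (less n)
    show ?case
    proof (induction r)
      case (Suc r)
      have "binomial_series s (Suc r) * binomial_series s q =
          binomial_series s r * binomial_series s q +
          fps_X * (binomial_series s (r + s) * binomial_series s q)"
        by (simp add: binomial_series_Suc assms algebra_simps)
      moreover have "binomial_series s (Suc r + q) =
          binomial_series s (r + q) + fps_X * binomial_series s (r + s + q)"
        by (simp add: binomial_series_Suc assms algebra_simps)
      ultimately show ?case
        using Suc less[of "n - 1" "r + s"] by (cases n) auto
    qed (simp add: binomial_series_0)
  qed
qed

lemma binomial_series_eq_power:
  assumes "s > 0"
  shows "binomial_series s r = binomial_series s 1 ^ r"
proof (induction r)
  case (Suc r)
  have "binomial_series s (Suc r) = binomial_series s 1 * binomial_series s r"
    by (simp add: binomial_series_add assms)
  then show ?case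
    by (simp only: Suc power_Suc)
qed (simp add: binomial_series_0)

lemma binomial_series_functional_eq:
  assumes "s > 0"
  shows "binomial_series s 1 = 1 + fps_X * binomial_series s 1 ^ s"
proof -
  have "binomial_series s 1 = 1 + fps_X * binomial_series s s"
    using binomial_series_Suc[OF assms, of 0] by (simp add: binomial_series_0)
  then show ?thesis
    unfolding binomial_series_eq_power[OF assms, of s] .
qed

section \<open>The binomial series satisfies the hook recurrence\<close>

lemma fps_deriv_power_Suc:
  fixes F :: "'a::comm_ring_1 fps"
  shows "fps_deriv (F ^ Suc n) = of_nat (Suc n) * F ^ n * fps_deriv F"
  by (simp add: fps_deriv_power fps_of_nat del: power_Suc of_nat_Suc)

text \<open>Here \<open>m = k + 2\<close>, so that the exponents \<open>m - 2\<close> and \<open>m - 1\<close> arising by differentiation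
  need no truncated subtraction. The constants are those of the vertex weight
  \<open>((m h - 1) t - h + 1) / ((m - 1) h) = a + b / h\<close>. The proof verifies \<open>1 - inverse A = Q\<close> by
  comparing constant terms and derivatives, where \<open>A = B ^ t\<close>.\<close>

lemma hook_recurrence_binomial_series:
  fixes k t :: nat
  defines "a \<equiv> (of_nat ((k + 2) * t) - 1) / of_nat (k + 1) :: rat"
    and "b \<equiv> (1 - of_nat t) / of_nat (k + 1) :: rat"
  assumes "t > 0"
  shows "hook_recurrence (k + 1) (\<lambda>h. a + b / of_nat h) (binomial_series ((k + 2) * t) t)"
proof -
  define s where "s = (k + 2) * t"
  have "s > 0"
    using assms by (simp add: s_def)
  define B where "B = binomial_series s 1"
  define A where "A = binomial_series s t"
  have A: "A = B ^ t"
    unfolding A_def B_def by (rule binomial_series_eq_power[OF \<open>s > 0\<close>])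
  have B: "B = 1 + fps_X * B ^ s"
    unfolding B_def by (rule binomial_series_functional_eq[OF \<open>s > 0\<close>])
  obtain u where u: "t = Suc u"
    using assms by (cases t) auto
  obtain p where p: "s = Suc p"
    using \<open>s > 0\<close> by (cases s) auto
  have A0: "fps_nth A 0 = 1"
    by (simp add: A_def binomial_series_def rothe_coeff_def)
  define B' where "B' = fps_deriv B"
  define A' where "A' = fps_deriv A"
  \<comment> \<open>This removes the variable of the series, leaving relations between \<open>B\<close> and \<open>B'\<close> only.\<close>
  have zB: "fps_X * B ^ s = B - 1"
    using B by (simp add: algebra_simps)
  have dB: "B' = B ^ s + fps_X * (of_nat s * B ^ p * B')"
  proof -
    have "B' = fps_deriv (1 + fps_X * B ^ s)"
      unfolding B'_def using B by simp
    then show ?thesis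
      by (simp add: fps_deriv_power_Suc B'_def p algebra_simps del: power_Suc of_nat_Suc)
  qed
  have dB2: "B' * B = B ^ s * B + of_nat s * (B - 1) * B'"
  proof -
    have "B' * B = B ^ s * B + of_nat s * (fps_X * B ^ s) * B'"
      by (subst dB) (simp add: p algebra_simps)
    then show ?thesis
      by (simp only: zB)
  qed
  have dA: "A' = of_nat t * B ^ u * B'"
    unfolding A'_def A B'_def u by (rule fps_deriv_power_Suc)
  have Am: "A ^ (k + 2) = B ^ s"
    by (simp only: A s_def mult.commute[of "k + 2"] power_mult)
  \<comment> \<open>The differential equation that \<open>1 - inverse A = Q\<close> becomes after differentiating and
    multiplying by \<open>A ^ 2\<close>.\<close>
  have ode: "A' = of_nat t * A ^ (k + 2) * A + (of_nat s - 1) * fps_X * A ^ (k + 2) * A'"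
  proof -
    have "of_nat t * A ^ (k + 2) * A + (of_nat s - 1) * fps_X * A ^ (k + 2) * A' =
       of_nat t * B ^ u * (B ^ s * B + (of_nat s - 1) * (fps_X * B ^ s) * B')"
      unfolding Am dA by (simp add: A u algebra_simps)
    also have "\<dots> = of_nat t * B ^ u * (B' * B - (B - 1) * B')"
      unfolding zB dB2 by (simp add: algebra_simps)
    also have "\<dots> = A'"
      by (simp add: dA algebra_simps)
    finally show ?thesis by simp
  qed
  \<comment> \<open>Integration supplies the factor \<open>1 / (j + 1)\<close> of the weight, multiplication by \<open>fps_X\<close> the
    constant part.\<close>
  define Q where "Q = fps_const a * fps_X * A ^ (k + 1) + fps_const b * fps_integral0 (A ^ (k + 1))"
  have dQ: "fps_deriv Q * A ^ 2 = A'"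
  proof -
    have c1: "fps_const (a + b) = of_nat t"
    proof -
      have num: "of_nat ((k + 2) * t) - 1 + (1 - of_nat t) = (of_nat t * of_nat (k + 1) :: rat)"
        by (simp add: algebra_simps)
      have "a + b = of_nat t"
        unfolding a_def b_def add_divide_distrib[symmetric] num by (simp del: of_nat_add)
      then show ?thesis by (simp add: fps_of_nat)
    qed
    have c2: "fps_const a * of_nat (k + 1) = of_nat s - 1"
    proof -
      have "a * of_nat (k + 1) = of_nat s - 1"
        unfolding a_def s_def by (simp del: of_nat_add of_nat_mult)
      moreover have "fps_const a * of_nat (k + 1) = fps_const (a * of_nat (k + 1))"
        by (simp only: fps_const_mult[symmetric] fps_of_nat)
      ultimately show ?thesis
        by (simp add: fps_of_nat flip: fps_const_sub)
    qed
    define P where "P = A ^ (k + 1)"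
    have dP: "fps_deriv P = of_nat (k + 1) * A ^ k * A'"
      using fps_deriv_power_Suc[of A k] by (simp add: A'_def P_def)
    have dQ': "fps_deriv Q = fps_const (a + b) * A ^ (k + 1) +
        (fps_const a * of_nat (k + 1)) * fps_X * A ^ k * A'"
      unfolding Q_def P_def[symmetric]
      by (simp add: dP fps_deriv_fps_integral algebra_simps flip: fps_const_add)
    have "fps_deriv Q * A ^ 2 =
        of_nat t * A ^ (k + 2) * A + (of_nat s - 1) * fps_X * A ^ (k + 2) * A'"
      unfolding dQ' c1 c2 by (simp add: algebra_simps power2_eq_square)
    then show ?thesis
      using ode by simp
  qed
  have Ainv: "inverse A * A = 1"
    by (rule inverse_mult_eq_1) (simp add: A0)
  have "fps_deriv (1 - inverse A) = fps_deriv Q"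
  proof -
    have "fps_deriv (1 - inverse A) = A' * inverse A ^ 2"
      by (simp add: fps_inverse_deriv A0 A'_def)
    also have "\<dots> = fps_deriv Q * (inverse A * A) ^ 2"
      unfolding dQ[symmetric] by (simp add: algebra_simps power2_eq_square)
    finally show ?thesis
      by (simp add: Ainv)
  qed
  moreover have "fps_nth (1 - inverse A) 0 = fps_nth Q 0"
    by (simp add: A0 Q_def)
  ultimately have "1 - inverse A = Q"
    by (metis add_0 diff_self fps_const_0_eq_0 fps_deriv_eq_iff)
  then have "(1 - inverse A) * A = Q * A" by simp
  then have A_eq: "A = 1 + Q * A"
    using Ainv by (simp add: algebra_simps)
  have Q0: "fps_nth Q 0 = 0"
    by (simp add: Q_def)
  have QS: "fps_nth Q (Suc j) = (a + b / of_nat (Suc j)) * fps_nth (A ^ (k + 1)) j" for j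
    by (simp add: Q_def mult.assoc field_simps del: of_nat_Suc power_Suc)
  have "fps_nth A (Suc n) =
      (\<Sum>j\<le>n. (a + b / of_nat (Suc j)) * fps_nth (A ^ (k + 1)) j * fps_nth A (n - j))" for n
  proof -
    have "fps_nth A (Suc n) = fps_nth (1 + Q * A) (Suc n)"
      using A_eq by simp
    also have "\<dots> = (\<Sum>i\<le>Suc n. fps_nth Q i * fps_nth A (Suc n - i))"
      by (simp add: fps_mult_nth atLeast0AtMost)
    also have "\<dots> = (\<Sum>j\<le>n. fps_nth Q (Suc j) * fps_nth A (n - j))"
      by (subst sum.atMost_Suc_shift) (simp add: Q0)
    finally show ?thesis
      by (simp only: QS)
  qed
  then show ?thesis
    unfolding hook_recurrence_def using A0 by (simp add: A_def s_def)
qed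

section \<open>The two identities\<close>

lemma rothe_coeff_binomial_poly:
  assumes "t > 0" "m > 0"
  shows "rothe_coeff (m * t) t n =
    poly (smult (1 / (of_nat (m * n) + 1)) (binomial_poly ((of_nat (m * n) + 1) * X) n)) (of_nat t)"
proof -
  have e: "m * t * n + t = (m * n + 1) * t"
    by (simp add: algebra_simps)
  have p: "poly (binomial_poly ((of_nat (m * n) + 1) * X) n) (of_nat t) = of_nat (((m * n + 1) * t) choose n)"
    by (simp add: binomial_poly_def poly_prod binomial_gbinomial gbinomial_prod_rev
          atLeast0LessThan algebra_simps)
  have q: "of_nat t / of_nat ((m * n + 1) * t) = 1 / (of_nat (m * n) + 1 :: rat)"
  proof -
    have "of_nat t / of_nat ((m * n + 1) * t) = 1 / (of_nat (m * n + 1) :: rat)"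
      using assms unfolding of_nat_mult[of "m * n + 1"]
      by (intro nonzero_divide_mult_cancel_right) simp
    then show ?thesis
      by (simp add: add.commute)
  qed
  show ?thesis
    unfolding rothe_coeff_def e q poly_smult p by auto
qed

lemma poly_eqI_infinite:
  fixes p q :: "'a::idom poly"
  assumes "infinite S" "\<And>x. x \<in> S \<Longrightarrow> poly p x = poly q x"
  shows "p = q"
proof (rule ccontr)
  assume "p \<noteq> q"
  then have "finite {x. poly (p - q) x = 0}"
    by (intro poly_roots_finite) simp
  moreover have "S \<subseteq> {x. poly (p - q) x = 0}"
    using assms by auto
  ultimately show False
    using assms(1) finite_subset by blast
qed

text \<open>The restriction to positive integers \<open>x = t\<close> lets \<open>t\<close> be an exponent and \<open>m * t\<close> an index of the
  binomial series.\<close>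

lemma sum_hook_products_binomial:
  fixes m n :: nat
  assumes "m \<ge> 2"
  shows "(\<Sum>T\<in>mary_trees n m. \<Prod>v\<in>internal_vertices T.
             smult (1 / ((of_nat m - 1) * of_nat (hook T v)))
               ((of_nat m * of_nat (hook T v) - 1) * X - of_nat (hook T v) + 1))
           = smult (1 / (of_nat (m * n) + 1)) (binomial_poly ((of_nat (m * n) + 1) * X) n)"
    (is "?L = ?R")
proof (rule poly_eqI_infinite)
  show "infinite (of_nat ` {0<..} :: rat set)"
    by (simp add: finite_image_iff inj_on_def infinite_Ioi)
  fix x :: rat assume "x \<in> of_nat ` {0<..}"
  then obtain t where t: "x = of_nat t" "t > 0"
    by auto
  obtain k where k: "m = k + 2"
    using assms by (metis add.commute le_Suc_ex)
  define a b :: rat where "a = (of_nat ((k + 2) * t) - 1) / of_nat (k + 1)"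
    and "b = (1 - of_nat t) / of_nat (k + 1)"
  define g where "g = (\<lambda>h. a + b / of_nat h)"
  have w: "poly (smult (1 / ((of_nat m - 1) * of_nat h))
      ((of_nat m * of_nat h - 1) * X - of_nat h + 1)) x = g h"
    if "h > 0" for h
  proof -
    have "poly (smult (1 / ((of_nat m - 1) * of_nat h))
        ((of_nat m * of_nat h - 1) * X - of_nat h + 1)) x
      = ((of_nat m * of_nat h - 1) * x - of_nat h + 1) / ((of_nat m - 1) * of_nat h)"
      by simp
    also have "\<dots> = ((of_nat m * x - 1) + (1 - x) / of_nat h) / (of_nat m - 1)"
      using that by (simp add: divide_simps k) (simp add: algebra_simps)
    also have "\<dots> = g h"
      by (simp add: g_def a_def b_def k t add_divide_distrib diff_divide_distrib algebra_simps)
    finally show ?thesis .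
  qed
  have "poly ?L x = (\<Sum>T\<in>mary_trees n m. hook_weight g T)"
    unfolding poly_sum poly_prod hook_weight_def
    by (intro sum.cong prod.cong refl w hook_pos)
  also have "\<dots> = fps_nth (tree_gf m g) n"
    by (simp add: tree_gf_def)
  also have "tree_gf m g = binomial_series ((k + 2) * t) t"
  proof (rule hook_recurrence_unique)
    show "hook_recurrence (k + 1) g (tree_gf m g)"
      using hook_recurrence_tree_gf[of "k + 1" g] by (simp add: k)
    show "hook_recurrence (k + 1) g (binomial_series ((k + 2) * t) t)"
      unfolding g_def a_def b_def by (rule hook_recurrence_binomial_series[OF t(2)])
  qed
  also have "fps_nth \<dots> n = rothe_coeff (m * t) t n"
    by (simp add: binomial_series_def k)
  also have "\<dots> = poly ?R x"
    using rothe_coeff_binomial_poly[of t m n] t assms by simp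
  finally show "poly ?L x = poly ?R x" .
qed

text \<open>For \<open>t = (x + 1) / (x + m)\<close>, the vertex weights are related by
  \<open>x + 1 / h = (x + m) ((m h - 1) t - h + 1) / ((m - 1) h)\<close>. The right-hand sides correspond in the
  same way, since \<open>(x + m) ((m n + 1) t - i) = (m n + 1 - i) (x + 1) - (m - 1) i\<close>, where the factor
  for \<open>i = 0\<close> is \<open>(m n + 1) (x + 1)\<close>. Infinitely many values \<open>x \<noteq> -m\<close> suffice to identify the
  polynomials.\<close>

lemma sum_hook_products_shifted:
  fixes m n :: nat
  assumes "m \<ge> 2" and "n \<ge> 1"
  shows "(\<Sum>T\<in>mary_trees n m. \<Prod>v\<in>internal_vertices T. X + [:1 / of_nat (hook T v):])
           = smult (1 / fact n) (X + 1) *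
             (\<Prod>i=1..n-1. (of_nat (m * n) + 1 - of_nat i) * (X + 1) - (of_nat m - 1) * of_nat i)"
    (is "?L = ?R")
proof (rule poly_eqI_infinite)
  show "infinite (UNIV - {- of_nat m :: rat})"
    by (simp add: infinite_UNIV_char_0)
  fix x :: rat assume "x \<in> UNIV - {- of_nat m}"
  then have c0: "x + of_nat m \<noteq> 0"
    by (simp add: add_eq_0_iff2)
  define c where "c = x + of_nat m"
  define t where "t = (x + 1) / c"
  have c: "c \<noteq> 0" "c * t = x + 1"
    using c0 by (auto simp: c_def t_def)
  have m1: "of_nat m - 1 \<noteq> (0::rat)"
    using assms by auto
  define N where "N h = (of_nat m * of_nat h - 1) * t - of_nat h + 1" for h :: nat
  have w: "poly (X + [:1 / of_nat h:]) x =
      c * poly (smult (1 / ((of_nat m - 1) * of_nat h))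
        ((of_nat m * of_nat h - 1) * X - of_nat h + 1)) t"
    if "h > 0" for h
  proof -
    have "c * poly (smult (1 / ((of_nat m - 1) * of_nat h))
        ((of_nat m * of_nat h - 1) * X - of_nat h + 1)) t
      = c * N h / ((of_nat m - 1) * of_nat h)"
      by (simp add: N_def)
    also have "c * N h = (of_nat m * of_nat h - 1) * (c * t) - c * (of_nat h - 1)"
      by (simp add: N_def algebra_simps)
    also have "\<dots> / ((of_nat m - 1) * of_nat h) = x + 1 / of_nat h"
      unfolding c(2) unfolding c_def using that m1 by (simp add: divide_simps) (simp add: algebra_simps)
    finally show ?thesis
      by simp
  qed
  have "poly ?L x = (\<Sum>T\<in>mary_trees n m. \<Prod>v\<in>internal_vertices T.
      c * poly (smult (1 / ((of_nat m - 1) * of_nat (hook T v)))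
      ((of_nat m * of_nat (hook T v) - 1) * X - of_nat (hook T v) + 1)) t)"
    unfolding poly_sum poly_prod by (intro sum.cong prod.cong refl w hook_pos)
  also have "\<dots> = (\<Sum>T\<in>mary_trees n m. c ^ n * (\<Prod>v\<in>internal_vertices T.
      poly (smult (1 / ((of_nat m - 1) * of_nat (hook T v)))
      ((of_nat m * of_nat (hook T v) - 1) * X - of_nat (hook T v) + 1)) t))"
    by (intro sum.cong refl) (simp only: prod.distrib prod_constant mary_trees_def mem_Collect_eq)
  also have "\<dots> = c ^ n * poly (smult (1 / (of_nat (m * n) + 1))
      (binomial_poly ((of_nat (m * n) + 1) * X) n)) t"
    unfolding sum_hook_products_binomial[OF assms(1), of n, symmetric] poly_sum poly_prod sum_distrib_left ..
  also have "\<dots> = 1 / (of_nat (m * n) + 1) / fact n *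
      (\<Prod>i<n. c * ((of_nat (m * n) + 1) * t - of_nat i))"
    by (simp add: binomial_poly_def poly_prod prod.distrib mult.commute[of t] del: of_nat_mult)
  also have "(\<Prod>i<n. c * ((of_nat (m * n) + 1) * t - of_nat i)) =
      (\<Prod>i<n. (of_nat (m * n) + 1) * (x + 1) - c * of_nat i)"
    unfolding c(2)[symmetric] by (simp add: algebra_simps)
  also have "\<dots> = (of_nat (m * n) + 1) * (x + 1) *
      (\<Prod>i=1..n-1. (of_nat (m * n) + 1) * (x + 1) - c * of_nat i)"
  proof -
    have "{..<n} = insert 0 {1..n-1}"
      using assms by auto
    then show ?thesis
      by simp
  qed
  also have "1 / (of_nat (m * n) + 1) / fact n * \<dots> = 1 / fact n * (x + 1) *
      (\<Prod>i=1..n-1. (of_nat (m * n) + 1) * (x + 1) - c * of_nat i)"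
  proof -
    have "of_nat (m * n) + 1 \<noteq> (0 :: rat)"
      by (metis of_nat_Suc of_nat_neq_0 add.commute)
    then show ?thesis by (simp add: divide_simps del: of_nat_mult)
  qed
  also have "\<dots> = poly ?R x"
    by (simp add: poly_prod c_def algebra_simps add_divide_distrib)
  finally show "poly ?L x = poly ?R x" .
qed

theorem theorem1p1:
  fixes m n :: nat
  assumes "m \<ge> 2" and "n \<ge> 1"
  shows "(\<Sum>T\<in>mary_trees n m. \<Prod>v\<in>internal_vertices T. X + [:1 / of_nat (hook T v):])
           = smult (1 / fact n) (X + 1) *
             (\<Prod>i=1..n-1. (of_nat (m * n) + 1 - of_nat i) * (X + 1) - (of_nat m - 1) * of_nat i)
       \<and> (\<Sum>T\<in>mary_trees n m. \<Prod>v\<in>internal_vertices T.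
             smult (1 / ((of_nat m - 1) * of_nat (hook T v)))
               ((of_nat m * of_nat (hook T v) - 1) * X - of_nat (hook T v) + 1))
           = smult (1 / (of_nat (m * n) + 1)) (binomial_poly ((of_nat (m * n) + 1) * X) n)"
  using sum_hook_products_shifted[OF assms] sum_hook_products_binomial[OF assms(1)] by blast

end
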